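(* Let $(X,M,Y)$ be a random element of $\mathbb{R}^d\times\{0,1\}^d\times\{-1,1\}$ such that $M$ is independent of $(X,Y)$. Assume that there exist $\beta_0^\star,\dots,\beta_d^\star\in\mathbb{R}$ such that $\mathbb{P}(Y=1|X)=\sigma\big(\beta_0^\star+\sum_{j=1}^d\beta_j^\star X_j\big)$. Assume furthermore that the components $X_1,\dots,X_d$ are independent, each one with an unbounded support, and satisfy $\mathbb{E}[\exp(\beta_j^\star X_j)]<\infty$ for all $j$. Let $m\in\{0,1\}^d$ be a pattern with $\mathbb{P}(M=m)>0$ and assume that the logistic model holds on the missing pattern $M=m$, that is, there exists a vector $\beta_m^\star\in\mathbb{R}^{|\mathrm{obs}(m)|+1}$ such that $$\mathbb{P}\big(Y=1|X_{\mathrm{obs}(m)},M=m\big)=\sigma\Big(\beta_{0,m}^\star+\sum_{j\in\mathrm{obs}(m)}\beta_{j,m}^\star X_j\Big).$$ Then, for all $j\in\mathrm{mis}(m)$, $\beta_j^\star=0$.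
   Context: $\sigma(t)=1/(1+e^{-t})$. For $m\in\{0,1\}^d$, $\mathrm{obs}(m)$ (resp. $\mathrm{mis}(m)$) is the set of indices $j$ with $m_j=0$ (resp. $m_j=1$), and $X_{\mathrm{obs}(m)}$ is the subvector of $X$ indexed by $\mathrm{obs}(m)$. "Unbounded support" is the paper's wording; in its proof the paper uses that the support of each $X_j$ is $\mathbb{R}$.
   Formalization: The formal theorem additionally assumes that β_j* ≠ 0 for some j in obs(m); without this the claim fails (if all observed coefficients vanish, the pattern model holds automatically). "Unbounded support" is read as each X_j having support ℝ. *)

theory Defs
  imports "HOL-Probability.Probability"
begin

definition sigmoid :: "real \<Rightarrow> real" where
  "sigmoid t = 1 / (1 + exp (- t))"

(* A pattern m in {0,1}^d is a boolean vector; True encodes 1, i.e. a missing entry. *)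
definition obs :: "bool ^ 'd \<Rightarrow> 'd set" where
  "obs m = {j. \<not> m $ j}"

definition mis :: "bool ^ 'd \<Rightarrow> 'd set" where
  "mis m = {j. m $ j}"

definition subvec :: "'d set \<Rightarrow> real ^ 'd \<Rightarrow> 'd \<Rightarrow> real" where
  "subvec J x = (\<lambda>j\<in>J. x $ j)"

definition topological_support :: "'a::topological_space measure \<Rightarrow> 'a set" where
  "topological_support \<mu> = {x. \<forall>U. open U \<longrightarrow> x \<in> U \<longrightarrow> emeasure \<mu> U > 0}"

(* P(A | Z) for a random variable Z with values in N. Like every conditional expectation, it is
   only determined up to P-null sets. *)
definition prob_given :: "'w measure \<Rightarrow> 'w set \<Rightarrow> 'b measure \<Rightarrow> ('w \<Rightarrow> 'b) \<Rightarrow> 'w \<Rightarrow> real" where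
  "prob_given P A N Z = real_cond_exp P (vimage_algebra (space P) Z N) (indicator A)"

(* Independence of random variables of different types; the library's indep_var requires both
   to have the same type. *)
definition indep_rvs ::
  "'w measure \<Rightarrow> 'b measure \<Rightarrow> ('w \<Rightarrow> 'b) \<Rightarrow> 'c measure \<Rightarrow> ('w \<Rightarrow> 'c) \<Rightarrow> bool" where
  "indep_rvs P N Z L W \<longleftrightarrow>
     prob_space.indep_set P (sets (vimage_algebra (space P) Z N))
       (sets (vimage_algebra (space P) W L))"

end

theory Submission
  imports Defs "HOL-Real_Asymp.Real_Asymp"
begin

text \<open>
  Split the linear predictor into \<open>S + V\<close>, where \<open>S\<close> collects the observed components and
  \<open>V\<close> the intercept and the missing ones. Since the pattern is independent of \<open>(X, Y)\<close>, the
  conditional probability of \<open>Y = 1\<close> on the pattern is the one given the observed components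
  without conditioning on the pattern (\<open>prob_given_uniform_measure_indep\<close>). Since \<open>S\<close> and
  \<open>V\<close> are independent, it equals \<open>G S\<close> with \<open>G s = E (sigmoid (s + V))\<close>. So the logistic
  model on the pattern says that \<open>G S\<close> is almost surely the sigmoid of an affine function of
  the observed components. Both sides are continuous and the components have full support, so
  the identity holds at every point (\<open>AE_zero_imp_zero_of_full_support\<close>). As some observed
  coefficient is nonzero, restricting to that axis gives \<open>G s = sigmoid (a + c s)\<close> for all real
  \<open>s\<close>.

  It remains to see that a genuine mixture of shifted sigmoids, with \<open>E (exp V)\<close> finite, is
  never such a function
  (\<open>sigmoid_mixture_affine_imp_AE_const\<close>). For \<open>s \<rightarrow> -\<infinity>\<close> the left side behaves like
  \<open>exp s * E (exp V)\<close> and the right side like \<open>exp (a + c s)\<close>, which forces \<open>c = 1\<close> and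
  \<open>E (exp V) = exp a\<close>. With \<open>W = exp V\<close> the identity at \<open>s = 0\<close> reads
  \<open>E (W / (1 + W)) = E W / (1 + E W)\<close>, the equality case of Jensen's inequality for a strictly
  concave function. So \<open>V\<close> is almost surely constant, and by full support the affine function
  defining it has no nonzero coefficient.
\<close>

section \<open>The sigmoid function\<close>

lemma continuous_on_sigmoid: "continuous_on A sigmoid"
proof -
  have "1 + exp (- t) \<noteq> 0" for t :: real
    using exp_gt_zero[of "- t"] by linarith
  then show ?thesis
    unfolding sigmoid_def[abs_def] by (intro continuous_intros) auto
qed

lemma sigmoid_measurable [measurable]: "sigmoid \<in> borel_measurable borel"
  by (intro borel_measurable_continuous_onI continuous_on_sigmoid)

lemma sigmoid_pos: "0 < sigmoid t"
  unfolding sigmoid_def by (auto intro!: divide_pos_pos add_pos_pos)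

lemma sigmoid_le_1: "sigmoid t \<le> 1"
  unfolding sigmoid_def by (auto simp: divide_simps) (smt (verit) exp_gt_zero)

lemma abs_sigmoid_le_1: "\<bar>sigmoid t\<bar> \<le> 1"
  using sigmoid_pos[of t] sigmoid_le_1[of t] by simp

text \<open>
  For fixed \<open>s\<close> this is a Moebius function of \<open>exp v\<close>; in this form both the limit
  \<open>s \<rightarrow> -\<infinity>\<close> and strict concavity in \<open>exp v\<close> are visible.
\<close>
lemma sigmoid_add: "sigmoid (s + v) = exp s * (exp v / (1 + exp s * exp v))"
proof -
  define r where "r = exp s * exp v"
  have "r > 0" and "exp (- (s + v)) = 1 / r"
    by (simp_all add: r_def exp_minus exp_add inverse_eq_divide del: minus_add_distrib)
  then have "sigmoid (s + v) = 1 / (1 + 1 / r)"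
    by (simp only: sigmoid_def)
  with \<open>r > 0\<close> have "sigmoid (s + v) = r / (1 + r)"
    by (simp add: field_simps)
  then show ?thesis
    by (simp add: r_def)
qed

section \<open>Mixtures of shifted sigmoids\<close>

lemma (in prob_space) integrable_bounded_by_1:
  fixes f :: "'a \<Rightarrow> real"
  assumes "f \<in> borel_measurable M" "\<And>\<omega>. \<bar>f \<omega>\<bar> \<le> 1"
  shows "integrable M f"
  using assms by (intro integrable_const_bound[where B = 1]) auto

lemma (in prob_space) continuous_on_expectation_sigmoid:
  assumes [measurable]: "random_variable borel V"
  shows "continuous_on A (\<lambda>s. expectation (\<lambda>\<omega>. sigmoid (s + V \<omega>)))"
proof -
  have "isCont (\<lambda>s. expectation (\<lambda>\<omega>. sigmoid (s + V \<omega>))) s" for s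
    unfolding continuous_at_sequentially o_def
  proof (intro allI impI)
    fix u :: "nat \<Rightarrow> real" assume u: "u \<longlonglongrightarrow> s"
    have "isCont sigmoid t" for t
      using continuous_on_sigmoid[of UNIV] by (simp add: continuous_on_eq_continuous_at)
    then have "(\<lambda>n. sigmoid (u n + V \<omega>)) \<longlonglongrightarrow> sigmoid (s + V \<omega>)" for \<omega>
      by (intro isCont_tendsto_compose[of _ sigmoid] tendsto_intros u)
    then show "(\<lambda>n. expectation (\<lambda>\<omega>. sigmoid (u n + V \<omega>)))
        \<longlonglongrightarrow> expectation (\<lambda>\<omega>. sigmoid (s + V \<omega>))"
      by (intro integral_dominated_convergence[where w = "\<lambda>_. 1"]) (auto simp: abs_sigmoid_le_1)
  qed
  then show ?thesis
    by (simp add: continuous_at_imp_continuous_on)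
qed

text \<open>
  As \<open>s \<rightarrow> -\<infinity>\<close> the sigmoid behaves like the exponential, so the mixture decays like
  \<open>exp s\<close> times the exponential moment of \<open>V\<close>. After division by \<open>exp s\<close> the integrand is
  dominated by \<open>exp V\<close>.
\<close>
lemma (in prob_space) expectation_exp_sigmoid_at_bot:
  assumes [measurable]: "random_variable borel V"
    and int: "integrable M (\<lambda>\<omega>. exp (V \<omega>))"
  shows "(\<lambda>n. exp (real n) * expectation (\<lambda>\<omega>. sigmoid (- real n + V \<omega>)))
           \<longlonglongrightarrow> expectation (\<lambda>\<omega>. exp (V \<omega>))"
proof -
  have eq: "exp (real n) * sigmoid (- real n + v) = exp v / (1 + exp (- real n) * exp v)" for n v
    unfolding sigmoid_add by (simp add: exp_minus)
  have "(\<lambda>n. expectation (\<lambda>\<omega>. exp (V \<omega>) / (1 + exp (- real n) * exp (V \<omega>))))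
          \<longlonglongrightarrow> expectation (\<lambda>\<omega>. exp (V \<omega>))"
  proof (rule integral_dominated_convergence[where w = "\<lambda>\<omega>. exp (V \<omega>)"])
    show "AE \<omega> in M. (\<lambda>n. exp (V \<omega>) / (1 + exp (- real n) * exp (V \<omega>))) \<longlonglongrightarrow> exp (V \<omega>)"
    proof (rule AE_I2)
      fix \<omega>
      define c where "c = exp (V \<omega>)"
      have "(\<lambda>n. c / (1 + exp (- real n) * c)) \<longlonglongrightarrow> c" by real_asymp
      then show "(\<lambda>n. exp (V \<omega>) / (1 + exp (- real n) * exp (V \<omega>))) \<longlonglongrightarrow> exp (V \<omega>)"
        by (simp add: c_def)
    qed
    show "AE \<omega> in M. norm (exp (V \<omega>) / (1 + exp (- real n) * exp (V \<omega>))) \<le> exp (V \<omega>)" for n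
      by (auto simp: divide_le_eq add_pos_pos mult_le_cancel_left1)
  qed (use int in auto)
  moreover have "exp (real n) * expectation (\<lambda>\<omega>. sigmoid (- real n + V \<omega>))
      = expectation (\<lambda>\<omega>. exp (V \<omega>) / (1 + exp (- real n) * exp (V \<omega>)))" for n
    by (simp flip: eq integral_mult_right_zero)
  ultimately show ?thesis by simp
qed

text \<open>
  The sigmoid of \<open>a - c n\<close> decays like \<open>exp (a - c n)\<close> if \<open>c > 0\<close> and does not decay
  otherwise. So only the slope \<open>c = 1\<close> balances the factor \<open>exp n\<close>.
\<close>
lemma exp_sigmoid_affine_at_bot:
  assumes lim: "(\<lambda>n. exp (real n) * sigmoid (a - c * real n)) \<longlonglongrightarrow> w" and "0 < w"
  shows "c = 1" "w = exp a"
proof -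
  have eq: "(\<lambda>n. exp (real n) * sigmoid (a - c * real n))
      = (\<lambda>n. exp (a + (1 - c) * real n) / (1 + exp (a - c * real n)))"
  proof
    fix n
    have "sigmoid (a - c * real n) = exp (a - c * real n) / (1 + exp (a - c * real n))"
      using sigmoid_add[of 0 "a - c * real n"] by simp
    then show "exp (real n) * sigmoid (a - c * real n)
        = exp (a + (1 - c) * real n) / (1 + exp (a - c * real n))"
      by (simp add: algebra_simps flip: exp_add)
  qed
  show c: "c = 1"
  proof (rule ccontr)
    assume "c \<noteq> 1"
    then consider "c > 1" | "0 < c" "c < 1" | "c = 0" | "c < 0" by linarith
    then show False
    proof cases
      case 1
      then have "(\<lambda>n. exp (real n) * sigmoid (a - c * real n)) \<longlonglongrightarrow> 0"
        unfolding eq by real_asymp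
      with lim \<open>0 < w\<close> show False using LIMSEQ_unique by fastforce
    next
      case 2
      then have "filterlim (\<lambda>n. exp (real n) * sigmoid (a - c * real n)) at_top sequentially"
        unfolding eq by real_asymp
      with lim show False
        using not_tendsto_and_filterlim_at_infinity filterlim_at_top_imp_at_infinity
          sequentially_bot by blast
    next
      case 3
      then have "filterlim (\<lambda>n. exp (real n) * sigmoid (a - c * real n)) at_top sequentially"
        using sigmoid_pos[of a] by simp real_asymp
      with lim show False
        using not_tendsto_and_filterlim_at_infinity filterlim_at_top_imp_at_infinity
          sequentially_bot by blast
    next
      case 4
      then have "filterlim (\<lambda>n. exp (real n) * sigmoid (a - c * real n)) at_top sequentially"
        unfolding sigmoid_def by real_asymp
      with lim show False
        using not_tendsto_and_filterlim_at_infinity filterlim_at_top_imp_at_infinity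
          sequentially_bot by blast
    qed
  qed
  have "(\<lambda>n. exp (real n) * sigmoid (a - c * real n)) \<longlonglongrightarrow> exp a"
    unfolding eq unfolding c by real_asymp
  with lim show "w = exp a" using LIMSEQ_unique by blast
qed

text \<open>
  The function \<open>x / (1 + x)\<close> is strictly concave on the nonnegative reals, so equality in
  Jensen's inequality forces \<open>W\<close> to be constant. The proof computes the gap between the
  tangent at the mean and the function: it is a nonnegative multiple of \<open>(W - w)\<^sup>2\<close>, and
  its expectation is zero.
\<close>
lemma (in prob_space) AE_eq_expectation_of_Jensen_eq:
  fixes W :: "'a \<Rightarrow> real"
  assumes int: "integrable M W" and nonneg: "\<And>\<omega>. 0 \<le> W \<omega>"
    and eq: "expectation (\<lambda>\<omega>. W \<omega> / (1 + W \<omega>)) = expectation W / (1 + expectation W)"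
  shows "AE \<omega> in M. W \<omega> = expectation W"
proof -
  define w where "w = expectation W"
  have [measurable]: "W \<in> borel_measurable M" using int by auto
  have w: "0 \<le> w" unfolding w_def using nonneg by (simp add: integral_nonneg_AE)
  have int_h: "integrable M (\<lambda>\<omega>. W \<omega> / (1 + W \<omega>))"
    by (rule integrable_bounded_by_1) (use int nonneg in \<open>auto simp: divide_le_eq_1 add_nonneg_pos add_pos_nonneg\<close>)
  define gap where "gap \<omega> = w / (1 + w) + (W \<omega> - w) / (1 + w)\<^sup>2 - W \<omega> / (1 + W \<omega>)" for \<omega>
  have gap_eq: "gap \<omega> = (W \<omega> - w)\<^sup>2 / ((1 + w)\<^sup>2 * (1 + W \<omega>))" for \<omega>
  proof -
    have "1 + w \<noteq> 0" "1 + W \<omega> \<noteq> 0" using w nonneg[of \<omega>] by auto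
    then show ?thesis
      unfolding gap_def by (simp add: divide_simps power2_eq_square) algebra
  qed
  have int_gap: "integrable M gap"
    unfolding gap_def[abs_def] using int int_h by simp
  have "expectation gap = 0"
    unfolding gap_def[abs_def] using int int_h eq by (simp add: prob_space flip: w_def)
  then have "AE \<omega> in M. gap \<omega> = 0"
    using integral_nonneg_eq_0_iff_AE[OF int_gap] w nonneg by (simp add: gap_eq)
  then show ?thesis
  proof (rule AE_mp, intro AE_I2 impI)
    fix \<omega> assume "gap \<omega> = 0"
    then show "W \<omega> = expectation W"
      unfolding gap_eq using w nonneg[of \<omega>] by (auto simp flip: w_def)
  qed
qed

text \<open>
  The analytic core: averaging over a random shift with finite exponential moment never yields
  a rescaled sigmoid, unless the shift is deterministic. The behaviour at \<open>-\<infinity>\<close> identifies \<open>c = 1\<close> and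
  \<open>E (exp V) = exp a\<close>. Hence the hypothesis at \<open>s = 0\<close> is the equality case of Jensen's
  inequality for \<open>exp V\<close>.
\<close>
lemma (in prob_space) sigmoid_mixture_affine_imp_AE_const:
  assumes V [measurable]: "random_variable borel V"
    and int: "integrable M (\<lambda>\<omega>. exp (V \<omega>))"
    and eq: "\<And>s. expectation (\<lambda>\<omega>. sigmoid (s + V \<omega>)) = sigmoid (a + c * s)"
  shows "AE \<omega> in M. V \<omega> = a"
proof -
  define w where "w = expectation (\<lambda>\<omega>. exp (V \<omega>))"
  have "w \<noteq> 0"
    unfolding w_def using integral_nonneg_eq_0_iff_AE[OF int] by (auto simp: emeasure_space_1)
  then have "0 < w"
    unfolding w_def by (simp add: less_le)
  have "(\<lambda>n. exp (real n) * sigmoid (a - c * real n)) \<longlonglongrightarrow> w"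
    using expectation_exp_sigmoid_at_bot[OF V int] unfolding eq w_def by simp
  with \<open>0 < w\<close> have c: "c = 1" and w: "w = exp a"
    by (auto dest: exp_sigmoid_affine_at_bot)
  have "expectation (\<lambda>\<omega>. exp (V \<omega>) / (1 + exp (V \<omega>))) = w / (1 + w)"
    using eq[of 0] sigmoid_add[of 0] by (simp add: w)
  then have "AE \<omega> in M. exp (V \<omega>) = w"
    using AE_eq_expectation_of_Jensen_eq[OF int] by (simp add: w_def)
  then show ?thesis
    by (simp add: w)
qed

section \<open>Conditional probabilities given a random variable\<close>

lemma sigma_finite_subalgebra_vimage_algebra:
  assumes P: "prob_space P" and Z: "Z \<in> measurable P N"
  shows "sigma_finite_subalgebra P (vimage_algebra (space P) Z N)"
proof -
  interpret prob_space P by fact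
  have sub: "subalgebra P (vimage_algebra (space P) Z N)"
    unfolding subalgebra_def using sets_vimage_algebra2[of Z "space P" N] measurable_space[OF Z] measurable_sets[OF Z]
    by auto
  show ?thesis
    by (intro sigma_finite_subalgebra.intro sub finite_measure.axioms(1)
        finite_measure_restr_to_subalg finite_measure_axioms)
qed

lemma sets_vimage_algebraD:
  assumes "Z \<in> measurable P N" "C \<in> sets (vimage_algebra (space P) Z N)"
  obtains B where "B \<in> sets N" "C = {\<omega> \<in> space P. Z \<omega> \<in> B}"
proof -
  have "Z \<in> space P \<rightarrow> space N"
    using measurable_space[OF assms(1)] by auto
  then obtain B where "B \<in> sets N" "C = Z -` B \<inter> space P"
    using assms(2) sets_vimage_algebra2[of Z "space P" N] by auto
  then show thesis
    by (intro that[of B]) auto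
qed

text \<open>
  This lemma and the next are the two directions of the defining property of conditional
  probability, with sets in the codomain of \<open>Z\<close> in place of the sub-sigma-algebra generated by
  it. The integrals depend only on the joint law of \<open>Z\<close> and the event, so the identities can
  be moved between measures that share this law.
\<close>
lemma integral_prob_given:
  assumes P: "prob_space P" and Z: "Z \<in> measurable P N" and A: "A \<in> sets P"
    and g: "g \<in> borel_measurable N"
    and eq: "AE \<omega> in P. prob_given P A N Z \<omega> = g (Z \<omega>)"
    and B: "B \<in> sets N"
  shows "(\<integral>\<omega>. indicator B (Z \<omega>) * g (Z \<omega>) \<partial>P) = (\<integral>\<omega>. indicator B (Z \<omega>) * indicator A \<omega> \<partial>P)"
proof -
  interpret prob_space P by fact
  interpret sigma_finite_subalgebra P "vimage_algebra (space P) Z N"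
    using P Z by (rule sigma_finite_subalgebra_vimage_algebra)
  note [measurable] = Z A g B
  define C where "C = Z -` B \<inter> space P"
  have ind: "indicator C \<omega> = indicator B (Z \<omega>)" if "\<omega> \<in> space P" for \<omega>
    using that by (auto simp: C_def indicator_def)
  have "C \<in> sets (vimage_algebra (space P) Z N)"
    unfolding C_def by (intro in_vimage_algebra B)
  moreover have "integrable P (indicator A :: _ \<Rightarrow> real)"
    using A by (simp add: emeasure_eq_measure)
  ultimately have "(\<integral>\<omega>\<in>C. indicator A \<omega> \<partial>P) = (\<integral>\<omega>\<in>C. prob_given P A N Z \<omega> \<partial>P)"
    unfolding prob_given_def by (rule real_cond_exp_intA[rotated])
  also have "\<dots> = (\<integral>\<omega>. indicator B (Z \<omega>) * g (Z \<omega>) \<partial>P)"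
    unfolding set_lebesgue_integral_def
  proof (rule integral_cong_AE)
    show "(\<lambda>\<omega>. indicator C \<omega> *\<^sub>R prob_given P A N Z \<omega>) \<in> borel_measurable P"
      unfolding C_def prob_given_def by measurable
    show "AE \<omega> in P. indicator C \<omega> *\<^sub>R prob_given P A N Z \<omega> = indicator B (Z \<omega>) * g (Z \<omega>)"
      using eq AE_space by eventually_elim (simp add: ind)
  qed measurable
  finally show ?thesis
    unfolding set_lebesgue_integral_def by (simp add: ind cong: Bochner_Integration.integral_cong)
qed

lemma prob_given_charact:
  assumes P: "prob_space P" and Z: "Z \<in> measurable P N" and A: "A \<in> sets P"
    and g: "g \<in> borel_measurable N" and int: "integrable P (\<lambda>\<omega>. g (Z \<omega>))"
    and eq: "\<And>B. B \<in> sets N \<Longrightarrow>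
      (\<integral>\<omega>. indicator B (Z \<omega>) * g (Z \<omega>) \<partial>P) = (\<integral>\<omega>. indicator B (Z \<omega>) * indicator A \<omega> \<partial>P)"
  shows "AE \<omega> in P. prob_given P A N Z \<omega> = g (Z \<omega>)"
proof -
  interpret prob_space P by fact
  interpret sigma_finite_subalgebra P "vimage_algebra (space P) Z N"
    using P Z by (rule sigma_finite_subalgebra_vimage_algebra)
  note [measurable] = Z A g
  show ?thesis
    unfolding prob_given_def
  proof (rule real_cond_exp_charact)
    fix C assume "C \<in> sets (vimage_algebra (space P) Z N)"
    with Z obtain B where B: "B \<in> sets N" and C: "C = {\<omega> \<in> space P. Z \<omega> \<in> B}"
      by (rule sets_vimage_algebraD)
    have ind: "indicator C \<omega> = indicator B (Z \<omega>)" if "\<omega> \<in> space P" for \<omega>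
      using that by (auto simp: C indicator_def)
    show "(\<integral>\<omega>\<in>C. indicator A \<omega> \<partial>P) = (\<integral>\<omega>\<in>C. g (Z \<omega>) \<partial>P)"
      unfolding set_lebesgue_integral_def using eq[OF B]
      by (simp add: ind cong: Bochner_Integration.integral_cong)
  next
    have "Z \<in> measurable (vimage_algebra (space P) Z N) N"
      using measurable_space[OF Z] by (intro measurable_vimage_algebra1) auto
    then show "(\<lambda>\<omega>. g (Z \<omega>)) \<in> borel_measurable (vimage_algebra (space P) Z N)"
      using g by (rule measurable_compose)
  qed (use int A in \<open>simp_all add: emeasure_eq_measure\<close>)
qed

section \<open>Independence\<close>

lemma distr_uniform_measure_indep:
  assumes P: "prob_space P" and W: "W \<in> measurable P L" and Z: "Z \<in> measurable P N"
    and ind: "indep_rvs P L W N Z" and B: "B \<in> sets L"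
    and pos: "measure P {\<omega> \<in> space P. W \<omega> \<in> B} > 0"
  shows "distr (uniform_measure P {\<omega> \<in> space P. W \<omega> \<in> B}) N Z = distr P N Z"
proof (rule measure_eqI)
  interpret prob_space P by fact
  note [measurable] = Z W B
  let ?A = "{\<omega> \<in> space P. W \<omega> \<in> B}"
  show "sets (distr (uniform_measure P ?A) N Z) = sets (distr P N Z)" by simp
  fix C assume "C \<in> sets (distr (uniform_measure P ?A) N Z)"
  then have C [measurable]: "C \<in> sets N" by simp
  have "?A = W -` B \<inter> space P" by auto
  then have "prob (?A \<inter> (Z -` C \<inter> space P)) = prob ?A * prob (Z -` C \<inter> space P)"
    using ind unfolding indep_rvs_def
    by (auto intro!: indep_setD in_vimage_algebra B C)
  then have "emeasure (uniform_measure P ?A) (Z -` C \<inter> space P) = emeasure P (Z -` C \<inter> space P)"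
    using pos by (simp add: emeasure_eq_measure divide_ennreal)
  then show "emeasure (distr (uniform_measure P ?A) N Z) C = emeasure (distr P N Z) C"
    by (simp add: emeasure_distr)
qed

text \<open>
  Conditioning on an event independent of \<open>Z\<close> leaves the law of \<open>Z\<close> unchanged. A regression
  identity for two quantities determined by \<open>Z\<close> involves only that law, so it can be
  transferred from the conditioned measure back to \<open>P\<close>. This is how independence of the
  missing-data mechanism enters.
\<close>
lemma prob_given_uniform_measure_indep:
  assumes P: "prob_space P" and W: "W \<in> measurable P L" and B: "B \<in> sets L"
    and Z: "Z \<in> measurable P K" and ind: "indep_rvs P L W K Z"
    and pos: "measure P {\<omega> \<in> space P. W \<omega> \<in> B} > 0"
    and f: "f \<in> measurable K N" and D: "D \<in> sets K"
    and g: "g \<in> borel_measurable N" and int: "integrable P (\<lambda>\<omega>. g (f (Z \<omega>)))"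
    and eq: "AE \<omega> in uniform_measure P {\<omega> \<in> space P. W \<omega> \<in> B}.
      prob_given (uniform_measure P {\<omega> \<in> space P. W \<omega> \<in> B}) {\<omega> \<in> space P. Z \<omega> \<in> D} N (\<lambda>\<omega>. f (Z \<omega>)) \<omega>
        = g (f (Z \<omega>))"
  shows "AE \<omega> in P. prob_given P {\<omega> \<in> space P. Z \<omega> \<in> D} N (\<lambda>\<omega>. f (Z \<omega>)) \<omega> = g (f (Z \<omega>))"
proof (rule prob_given_charact[OF P _ _ g int])
  interpret prob_space P by fact
  define Q where "Q = uniform_measure P {\<omega> \<in> space P. W \<omega> \<in> B}"
  note [measurable] = Z W B f D g
  have Q: "prob_space Q"
    unfolding Q_def using pos by (intro prob_space_uniform_measure) (auto simp: emeasure_eq_measure)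
  have setsQ [measurable_cong]: "sets Q = sets P" and spaceQ: "space Q = space P"
    by (simp_all add: Q_def)
  have law: "distr Q K Z = distr P K Z"
    unfolding Q_def using P W Z ind B pos by (rule distr_uniform_measure_indep)
  have transfer: "(\<integral>\<omega>. h (Z \<omega>) \<partial>Q) = (\<integral>\<omega>. h (Z \<omega>) \<partial>P)"
    if [measurable]: "h \<in> borel_measurable K" for h :: "_ \<Rightarrow> real"
  proof -
    have "(\<integral>\<omega>. h (Z \<omega>) \<partial>Q) = (\<integral>z. h z \<partial>distr Q K Z)"
      by (subst integral_distr) auto
    also have "\<dots> = (\<integral>\<omega>. h (Z \<omega>) \<partial>P)"
      unfolding law by (subst integral_distr) auto
    finally show ?thesis .
  qed
  show "(\<lambda>\<omega>. f (Z \<omega>)) \<in> measurable P N" "{\<omega> \<in> space P. Z \<omega> \<in> D} \<in> sets P"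
    by measurable
  fix C assume C [measurable]: "C \<in> sets N"
  have ind: "indicator {\<omega> \<in> space P. Z \<omega> \<in> D} \<omega> = indicator D (Z \<omega>)" if "\<omega> \<in> space P" for \<omega>
    using that by (auto simp: indicator_def)
  have "(\<integral>\<omega>. indicator C (f (Z \<omega>)) * g (f (Z \<omega>)) \<partial>Q)
      = (\<integral>\<omega>. indicator C (f (Z \<omega>)) * indicator {\<omega> \<in> space P. Z \<omega> \<in> D} \<omega> \<partial>Q)"
    by (rule integral_prob_given[OF Q _ _ g _ C]) (use eq[folded Q_def] in simp_all)
  also have "\<dots> = (\<integral>\<omega>. indicator C (f (Z \<omega>)) * indicator D (Z \<omega>) \<partial>Q)"
    by (intro Bochner_Integration.integral_cong) (simp_all add: ind spaceQ)
  also have "\<dots> = (\<integral>\<omega>. indicator C (f (Z \<omega>)) * indicator D (Z \<omega>) \<partial>P)"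
    by (rule transfer) measurable
  also have "\<dots> = (\<integral>\<omega>. indicator C (f (Z \<omega>)) * indicator {\<omega> \<in> space P. Z \<omega> \<in> D} \<omega> \<partial>P)"
    by (intro Bochner_Integration.integral_cong) (simp_all add: ind)
  finally show "(\<integral>\<omega>. indicator C (f (Z \<omega>)) * g (f (Z \<omega>)) \<partial>P)
      = (\<integral>\<omega>. indicator C (f (Z \<omega>)) * indicator {\<omega> \<in> space P. Z \<omega> \<in> D} \<omega> \<partial>P)"
    by (subst (asm) transfer) measurable
qed

lemma (in prob_space) expectation_indep_average:
  fixes f :: "'b \<times> 'b \<Rightarrow> real"
  assumes ind: "indep_var S U T V"
    and f [measurable]: "f \<in> borel_measurable (S \<Otimes>\<^sub>M T)"
    and int: "integrable M (\<lambda>\<omega>. f (U \<omega>, V \<omega>))"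
  shows "expectation (\<lambda>\<omega>. f (U \<omega>, V \<omega>)) = expectation (\<lambda>\<omega>. expectation (\<lambda>\<omega>'. f (U \<omega>, V \<omega>')))"
proof -
  have U [measurable]: "U \<in> measurable M S" and V [measurable]: "V \<in> measurable M T"
    and law: "distr M S U \<Otimes>\<^sub>M distr M T V = distr M (S \<Otimes>\<^sub>M T) (\<lambda>\<omega>. (U \<omega>, V \<omega>))"
    using ind by (auto simp: indep_var_distribution_eq)
  interpret U: prob_space "distr M S U" by (rule prob_space_distr) fact
  interpret V: prob_space "distr M T V" by (rule prob_space_distr) fact
  interpret UV: pair_prob_space "distr M S U" "distr M T V" ..
  have "integrable (distr M S U \<Otimes>\<^sub>M distr M T V) f"
    unfolding law using int by (simp add: integrable_distr_eq)
  then have "(\<integral>u. \<integral>v. f (u, v) \<partial>distr M T V \<partial>distr M S U) = (\<integral>p. f p \<partial>(distr M S U \<Otimes>\<^sub>M distr M T V))"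
    by (rule UV.integral_fst')
  also have "\<dots> = expectation (\<lambda>\<omega>. f (U \<omega>, V \<omega>))"
    unfolding law by (subst integral_distr) auto
  also have "(\<integral>u. \<integral>v. f (u, v) \<partial>distr M T V \<partial>distr M S U)
      = expectation (\<lambda>\<omega>. \<integral>v. f (U \<omega>, v) \<partial>distr M T V)"
    by (subst integral_distr) auto
  also have "\<dots> = expectation (\<lambda>\<omega>. expectation (\<lambda>\<omega>'. f (U \<omega>, V \<omega>')))"
    by (intro Bochner_Integration.integral_cong refl, subst integral_distr)
       (use U in \<open>auto dest: measurable_space\<close>)
  finally show ?thesis ..
qed

section \<open>Full support\<close>

text \<open>
  Independent components with full support charge every open box, hence every nonempty open
  set; so almost sure identities between continuous functions of \<open>X\<close> hold everywhere.
\<close>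
lemma (in prob_space) AE_zero_imp_zero_of_full_support:
  fixes X :: "'a \<Rightarrow> real ^ 'd" and F :: "real ^ 'd \<Rightarrow> real"
  assumes X: "random_variable borel X"
    and ind: "indep_vars (\<lambda>_. borel) (\<lambda>j \<omega>. X \<omega> $ j) UNIV"
    and supp: "\<And>j. topological_support (distr M borel (\<lambda>\<omega>. X \<omega> $ j)) = UNIV"
    and F: "continuous_on UNIV F" and AE: "AE \<omega> in M. F (X \<omega>) = 0"
  shows "F x = 0"
proof (rule ccontr)
  note [measurable] = X
  assume "F x \<noteq> 0"
  have "open {y. F y \<noteq> 0}"
    using F by (intro open_Collect_neq) auto
  with \<open>F x \<noteq> 0\<close> obtain A where A: "\<And>j. open (A j)" "\<And>j. x $ j \<in> A j"
    and sub: "\<And>y. (\<And>j. y $ j \<in> A j) \<Longrightarrow> F y \<noteq> 0"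
    unfolding open_vec_def by (auto, metis)
  have Xj [measurable]: "(\<lambda>\<omega>. X \<omega> $ j) \<in> borel_measurable M" for j
    using ind by (auto simp: indep_vars_def)
  have Ab: "A j \<in> sets borel" for j using A(1) by simp
  have pos: "0 < prob ((\<lambda>\<omega>. X \<omega> $ j) -` A j \<inter> space M)" for j
  proof -
    have "x $ j \<in> topological_support (distr M borel (\<lambda>\<omega>. X \<omega> $ j))"
      using supp by simp
    then have "0 < emeasure (distr M borel (\<lambda>\<omega>. X \<omega> $ j)) (A j)"
      unfolding topological_support_def using A by blast
    then show ?thesis
      using Ab by (simp add: emeasure_distr emeasure_eq_measure)
  qed
  let ?E = "\<Inter>j. (\<lambda>\<omega>. X \<omega> $ j) -` A j \<inter> space M"
  have "prob ?E = (\<Prod>j\<in>UNIV. prob ((\<lambda>\<omega>. X \<omega> $ j) -` A j \<inter> space M))"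
    using ind by (rule indep_varsD) (use Ab in auto)
  also have "\<dots> > 0"
    using pos by (intro prod_pos) auto
  finally have "prob ?E > 0" .
  moreover have "?E \<in> events"
    using Ab by auto
  moreover have "AE \<omega> in M. \<omega> \<notin> ?E"
    using AE by eventually_elim (use sub in auto)
  then have "prob ?E = 0"
    using prob_eq_0 \<open>?E \<in> events\<close> by blast
  ultimately show False by simp
qed

section \<open>Logistic models on a missing pattern\<close>

lemma (in prob_space) indep_var_subvec_obs_mis:
  fixes X :: "'a \<Rightarrow> real ^ 'd" and \<beta> :: "real ^ 'd"
  assumes "indep_vars (\<lambda>_. borel) (\<lambda>j \<omega>. X \<omega> $ j) UNIV"
  shows "indep_var (Pi\<^sub>M (obs m) (\<lambda>_. borel)) (\<lambda>\<omega>. subvec (obs m) (X \<omega>))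
           (Pi\<^sub>M (mis m) (\<lambda>_. borel)) (\<lambda>\<omega>. subvec (mis m) (X \<omega>))"
  unfolding subvec_def using assms
  by (rule indep_var_restrict) (auto simp: obs_def mis_def)

theorem proposition4p1:
  fixes P :: "'w measure"
    and X :: "'w \<Rightarrow> real ^ 'd"
    and M :: "'w \<Rightarrow> bool ^ 'd"
    and Y :: "'w \<Rightarrow> int"
    and \<beta>0 :: real and \<beta> :: "real ^ 'd"
    and m :: "bool ^ 'd"
  assumes "prob_space P"
    and "X \<in> measurable P borel"
    and "M \<in> measurable P (count_space UNIV)"
    and "Y \<in> measurable P (count_space {-1, 1})"
    and "indep_rvs P (count_space UNIV) M
           (borel \<Otimes>\<^sub>M count_space {-1, 1}) (\<lambda>\<omega>. (X \<omega>, Y \<omega>))"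
    and "AE \<omega> in P. prob_given P {\<omega> \<in> space P. Y \<omega> = 1} borel X \<omega>
           = sigmoid (\<beta>0 + (\<Sum>j\<in>UNIV. \<beta> $ j * X \<omega> $ j))"
    and "prob_space.indep_vars P (\<lambda>_. borel) (\<lambda>j \<omega>. X \<omega> $ j) UNIV"
    and "\<forall>j. topological_support (distr P borel (\<lambda>\<omega>. X \<omega> $ j)) = UNIV"
    and "\<forall>j. integrable P (\<lambda>\<omega>. exp (\<beta> $ j * X \<omega> $ j))"
    and "measure P {\<omega> \<in> space P. M \<omega> = m} > 0"
    and "\<exists>\<beta>0m :: real. \<exists>\<beta>m :: 'd \<Rightarrow> real.
           AE \<omega> in uniform_measure P {\<omega> \<in> space P. M \<omega> = m}.
             prob_given (uniform_measure P {\<omega> \<in> space P. M \<omega> = m})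
               {\<omega> \<in> space P. Y \<omega> = 1}
               (Pi\<^sub>M (obs m) (\<lambda>_. borel)) (\<lambda>\<omega>. subvec (obs m) (X \<omega>)) \<omega>
             = sigmoid (\<beta>0m + (\<Sum>j\<in>obs m. \<beta>m j * X \<omega> $ j))"
    and "\<exists>j\<in>obs m. \<beta> $ j \<noteq> 0"
  shows "\<forall>j\<in>mis m. \<beta> $ j = 0"
proof -
  interpret prob_space P by fact
  note X [measurable] = assms(2) and M [measurable] = assms(3) and Y [measurable] = assms(4)
  note indX = assms(7)
  let ?O = "Pi\<^sub>M (obs m) (\<lambda>_. borel) :: ('d \<Rightarrow> real) measure"
  let ?N = "Pi\<^sub>M (mis m) (\<lambda>_. borel) :: ('d \<Rightarrow> real) measure"
  let ?A = "{\<omega> \<in> space P. Y \<omega> = 1}"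
  obtain \<beta>0m \<beta>m where model_m: "AE \<omega> in uniform_measure P {\<omega> \<in> space P. M \<omega> = m}.
      prob_given (uniform_measure P {\<omega> \<in> space P. M \<omega> = m}) ?A ?O (\<lambda>\<omega>. subvec (obs m) (X \<omega>)) \<omega>
        = sigmoid (\<beta>0m + (\<Sum>j\<in>obs m. \<beta>m j * X \<omega> $ j))"
    using assms(11) by blast
  \<comment> \<open>The linear predictor is \<open>S + V\<close>, with \<open>S\<close> a function of the observed and \<open>V\<close> of the
    missing components, independent of each other. \<open>G s\<close> averages the logistic model over \<open>V\<close>.\<close>
  define V where "V \<omega> = \<beta>0 + (\<Sum>j\<in>mis m. \<beta> $ j * X \<omega> $ j)" for \<omega>
  define G where "G s = expectation (\<lambda>\<omega>. sigmoid (s + V \<omega>))" for s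
  have Xj [measurable]: "(\<lambda>\<omega>. X \<omega> $ j) \<in> borel_measurable P" for j
    using indX by (auto simp: indep_vars_def)
  have V [measurable]: "V \<in> borel_measurable P"
    unfolding V_def[abs_def] by measurable
  have split: "\<beta>0 + (\<Sum>j\<in>UNIV. \<beta> $ j * X \<omega> $ j) = (\<Sum>j\<in>obs m. \<beta> $ j * X \<omega> $ j) + V \<omega>" for \<omega>
  proof -
    have "(\<Sum>j\<in>UNIV. \<beta> $ j * X \<omega> $ j) = (\<Sum>j\<in>obs m \<union> mis m. \<beta> $ j * X \<omega> $ j)"
      by (rule sum.cong) (auto simp: obs_def mis_def)
    also have "\<dots> = (\<Sum>j\<in>obs m. \<beta> $ j * X \<omega> $ j) + (\<Sum>j\<in>mis m. \<beta> $ j * X \<omega> $ j)"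
      by (rule sum.union_disjoint) (auto simp: obs_def mis_def)
    finally show ?thesis by (simp add: V_def)
  qed
  have contG: "continuous_on S G" for S
    unfolding G_def[abs_def] using V by (rule continuous_on_expectation_sigmoid)
  have G_meas [measurable]: "G \<in> borel_measurable borel"
    using contG by (rule borel_measurable_continuous_onI)
  have absG: "\<bar>G s\<bar> \<le> 1" for s
  proof -
    have "0 \<le> G s"
      unfolding G_def using sigmoid_pos by (intro integral_nonneg_AE AE_I2 less_imp_le) auto
    moreover have "G s \<le> 1"
      unfolding G_def by (intro integral_le_const integrable_bounded_by_1 AE_I2)
        (auto simp: abs_sigmoid_le_1 sigmoid_le_1)
    ultimately show ?thesis by simp
  qed
  have sub [measurable]: "(\<lambda>x. subvec J x) \<in> measurable borel (Pi\<^sub>M J (\<lambda>_. borel))"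
    for J :: "'d set"
    unfolding subvec_def by (intro measurable_restrict) simp
  have subX [measurable]: "(\<lambda>\<omega>. subvec J (X \<omega>)) \<in> measurable P (Pi\<^sub>M J (\<lambda>_. borel))"
    for J :: "'d set"
    using X sub by (rule measurable_compose)
  have sum_sub: "(\<Sum>j\<in>J. b j * subvec J x j) = (\<Sum>j\<in>J. b j * x $ j)"
    for b :: "'d \<Rightarrow> real" and J x
    by (simp add: subvec_def)
  have sum_meas [measurable]: "(\<lambda>u. \<Sum>j\<in>J. b j * u j) \<in> borel_measurable (Pi\<^sub>M J (\<lambda>_. borel))"
    for b :: "'d \<Rightarrow> real" and J
    by measurable
  have A: "?A \<in> sets P" by measurable

  \<comment> \<open>Missingness carries no information: the model on the pattern is a statement about \<open>P\<close>.\<close>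
  have full: "AE \<omega> in P. prob_given P ?A ?O (\<lambda>\<omega>. subvec (obs m) (X \<omega>)) \<omega>
      = sigmoid (\<beta>0m + (\<Sum>j\<in>obs m. \<beta>m j * X \<omega> $ j))"
  proof -
    let ?K = "borel \<Otimes>\<^sub>M count_space {- 1, 1} :: ((real ^ 'd) \<times> int) measure"
    have D: "UNIV \<times> {1} \<in> sets ?K" by (intro pair_measureI) auto
    have f: "(\<lambda>z. subvec (obs m) (fst z)) \<in> measurable ?K ?O" by measurable
    have g: "(\<lambda>u. sigmoid (\<beta>0m + (\<Sum>j\<in>obs m. \<beta>m j * u j))) \<in> borel_measurable ?O" by measurable
    show ?thesis
      using prob_given_uniform_measure_indep[OF assms(1) M, of "{m}" "\<lambda>\<omega>. (X \<omega>, Y \<omega>)" ?K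
          "\<lambda>z. subvec (obs m) (fst z)" ?O "UNIV \<times> {1}"
          "\<lambda>u. sigmoid (\<beta>0m + (\<Sum>j\<in>obs m. \<beta>m j * u j))",
          unfolded singleton_iff] assms(5,10) D f g model_m
      by (simp add: sum_sub integrable_bounded_by_1 abs_sigmoid_le_1)
  qed

  \<comment> \<open>The same conditional probability computed from the complete-data model, by Fubini.\<close>
  have averaged: "AE \<omega> in P. prob_given P ?A ?O (\<lambda>\<omega>. subvec (obs m) (X \<omega>)) \<omega>
      = G (\<Sum>j\<in>obs m. \<beta> $ j * X \<omega> $ j)"
  proof -
    have "AE \<omega> in P. prob_given P ?A ?O (\<lambda>\<omega>. subvec (obs m) (X \<omega>)) \<omega>
        = (\<lambda>u. G (\<Sum>j\<in>obs m. \<beta> $ j * u j)) (subvec (obs m) (X \<omega>))"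
    proof (rule prob_given_charact[OF assms(1) subX A])
      show "(\<lambda>u. G (\<Sum>j\<in>obs m. \<beta> $ j * u j)) \<in> borel_measurable ?O" by measurable
      show "integrable P (\<lambda>\<omega>. G (\<Sum>j\<in>obs m. \<beta> $ j * subvec (obs m) (X \<omega>) j))"
        by (rule integrable_bounded_by_1) (measurable, simp add: absG)
      fix B assume B [measurable]: "B \<in> sets ?O"
      define h where "h = (\<lambda>(u, v). indicator B u
          * sigmoid ((\<Sum>j\<in>obs m. \<beta> $ j * u j) + (\<beta>0 + (\<Sum>j\<in>mis m. \<beta> $ j * v j))))"
      have h [measurable]: "h \<in> borel_measurable (?O \<Otimes>\<^sub>M ?N)"
        unfolding h_def by measurable
      have h_eq: "h (subvec (obs m) (X \<omega>), subvec (mis m) (X \<omega>')) = indicator B (subvec (obs m) (X \<omega>))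
          * sigmoid ((\<Sum>j\<in>obs m. \<beta> $ j * X \<omega> $ j) + V \<omega>')" for \<omega> \<omega>'
        by (simp add: h_def sum_sub V_def)
      have int: "integrable P (\<lambda>\<omega>. h (subvec (obs m) (X \<omega>), subvec (mis m) (X \<omega>)))"
        by (rule integrable_bounded_by_1) (measurable, simp add: h_eq abs_sigmoid_le_1 indicator_def)
      define C where "C = subvec (obs m) -` B"
      have C [measurable]: "C \<in> sets borel"
        unfolding C_def using measurable_sets[OF sub B] by simp
      have ind: "indicator C (X \<omega>) = (indicator B (subvec (obs m) (X \<omega>)) :: real)" for \<omega>
        by (simp add: C_def indicator_def)
      have "(\<integral>\<omega>. indicator B (subvec (obs m) (X \<omega>)) * indicator ?A \<omega> \<partial>P)
          = (\<integral>\<omega>. indicator C (X \<omega>) * sigmoid (\<beta>0 + (\<Sum>j\<in>UNIV. \<beta> $ j * X \<omega> $ j)) \<partial>P)"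
        by (subst integral_prob_given[OF assms(1) X A _ assms(6) C]) (simp_all add: ind)
      also have "\<dots> = expectation (\<lambda>\<omega>. h (subvec (obs m) (X \<omega>), subvec (mis m) (X \<omega>)))"
        by (simp add: h_eq ind split)
      also have "\<dots> = expectation (\<lambda>\<omega>. expectation
          (\<lambda>\<omega>'. h (subvec (obs m) (X \<omega>), subvec (mis m) (X \<omega>'))))"
        using indep_var_subvec_obs_mis[OF indX] h int by (rule expectation_indep_average)
      also have "\<dots> = expectation (\<lambda>\<omega>. indicator B (subvec (obs m) (X \<omega>))
          * G (\<Sum>j\<in>obs m. \<beta> $ j * subvec (obs m) (X \<omega>) j))"
        by (simp add: h_eq G_def sum_sub)
      finally show "expectation (\<lambda>\<omega>. indicator B (subvec (obs m) (X \<omega>))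
          * G (\<Sum>j\<in>obs m. \<beta> $ j * subvec (obs m) (X \<omega>) j))
        = (\<integral>\<omega>. indicator B (subvec (obs m) (X \<omega>)) * indicator ?A \<omega> \<partial>P)" ..
    qed
    then show ?thesis by (simp add: sum_sub)
  qed

  have everywhere: "G (\<Sum>j\<in>obs m. \<beta> $ j * x $ j) = sigmoid (\<beta>0m + (\<Sum>j\<in>obs m. \<beta>m j * x $ j))"
    for x :: "real ^ 'd"
  proof -
    have "AE \<omega> in P. G (\<Sum>j\<in>obs m. \<beta> $ j * X \<omega> $ j)
        - sigmoid (\<beta>0m + (\<Sum>j\<in>obs m. \<beta>m j * X \<omega> $ j)) = 0"
      using full averaged by eventually_elim simp
    moreover have "continuous_on UNIV (\<lambda>x :: real ^ 'd. G (\<Sum>j\<in>obs m. \<beta> $ j * x $ j)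
        - sigmoid (\<beta>0m + (\<Sum>j\<in>obs m. \<beta>m j * x $ j)))"
      by (intro continuous_on_diff continuous_on_compose2[OF contG[of UNIV]]
          continuous_on_compose2[OF continuous_on_sigmoid[of UNIV]] continuous_intros) auto
    ultimately show ?thesis
      using AE_zero_imp_zero_of_full_support[OF X indX, of
          "\<lambda>x. G (\<Sum>j\<in>obs m. \<beta> $ j * x $ j) - sigmoid (\<beta>0m + (\<Sum>j\<in>obs m. \<beta>m j * x $ j))" x]
        assms(8) by simp
  qed

  \<comment> \<open>Moving along one observed axis with nonzero coefficient makes \<open>S\<close> run through all reals.\<close>
  obtain k where k: "k \<in> obs m" "\<beta> $ k \<noteq> 0" using assms(12) by blast
  have "G s = sigmoid (\<beta>0m + \<beta>m k / \<beta> $ k * s)" for s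
  proof -
    have axis: "(\<Sum>j\<in>obs m. b j * axis k t $ j) = b k * t" for b :: "'d \<Rightarrow> real" and t
      using k by (subst sum.remove[of _ k]) (auto simp: axis_def)
    show ?thesis
      using everywhere[of "axis k (s / \<beta> $ k)"] k by (simp add: axis)
  qed
  moreover have "integrable P (\<lambda>\<omega>. exp (V \<omega>))"
  proof -
    have "indep_vars (\<lambda>_. borel) (\<lambda>j \<omega>. exp (\<beta> $ j * X \<omega> $ j)) (mis m)"
      by (rule indep_vars_compose2[OF indep_vars_subset[OF indX]]) auto
    then have "integrable P (\<lambda>\<omega>. \<Prod>j\<in>mis m. exp (\<beta> $ j * X \<omega> $ j))"
      using assms(9) by (intro indep_vars_integrable) auto
    then show ?thesis
      by (simp add: V_def exp_add exp_sum)
  qed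
  ultimately have "AE \<omega> in P. V \<omega> = \<beta>0m"
    unfolding G_def using V by (intro sigmoid_mixture_affine_imp_AE_const[where c = "\<beta>m k / \<beta> $ k"]) auto
  \<comment> \<open>An affine function of components with full support is constant only if it is trivially so.\<close>
  then have "AE \<omega> in P. \<beta>0 + (\<Sum>j\<in>mis m. \<beta> $ j * X \<omega> $ j) - \<beta>0m = 0"
    by (simp add: V_def)
  moreover have "continuous_on UNIV (\<lambda>x :: real ^ 'd. \<beta>0 + (\<Sum>j\<in>mis m. \<beta> $ j * x $ j) - \<beta>0m)"
    by (intro continuous_intros)
  ultimately have const: "\<beta>0 + (\<Sum>j\<in>mis m. \<beta> $ j * x $ j) - \<beta>0m = 0" for x
    using AE_zero_imp_zero_of_full_support[OF X indX, of
        "\<lambda>x. \<beta>0 + (\<Sum>j\<in>mis m. \<beta> $ j * x $ j) - \<beta>0m" x] assms(8) by simp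
  show ?thesis
  proof
    fix i assume i: "i \<in> mis m"
    have "(\<Sum>j\<in>mis m. \<beta> $ j * axis i 1 $ j) = \<beta> $ i"
      using i by (subst sum.remove[of _ i]) (auto simp: axis_def)
    then show "\<beta> $ i = 0"
      using const[of "axis i 1"] const[of 0] by simp
  qed
qed

end
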